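(* Let $m\ge 1$ be an integer, let $Z=(Z_1,Z_2,Z_3)$ be real variables, and put $u=Z_3$, $v=-Z_1-Z_2-Z_3$, $t=-Z_2$. Let $$\mathcal P_m(Z)=\frac{1}{2\binom{2m}{m}}\,\frac{(u+v-t)^{2m}+t^{2m}-u^{2m}-v^{2m}}{(u-t)(v-t)},$$ regarded as a polynomial in $Z$. Let $\mathbf W_m(Z)=(Z^\alpha)_{|\alpha|=m-1}$ be the vector of all monomials $Z^\alpha=Z_1^{\alpha_1}Z_2^{\alpha_2}Z_3^{\alpha_3}$ with $\alpha=(\alpha_1,\alpha_2,\alpha_3)\in\mathbb N^3$ and $|\alpha|=\alpha_1+\alpha_2+\alpha_3=m-1$. Then there is a positive semidefinite matrix $M_{2,m}^{\rm PSD}\succeq 0$, indexed by such multi-indices, with $$\mathcal P_m(Z)=\mathbf W_m(Z)^T M_{2,m}^{\rm PSD}\,\mathbf W_m(Z).$$ Moreover, one may take $M_{2,m}^{\rm PSD}=(M^{(m)}_{\alpha,\beta})_{|\alpha|=|\beta|=m-1}$ with entries $$M^{(m)}_{\alpha,\beta}=\frac{m(2m-1)}{\binom{2m}{m}}\binom{m-1}{\alpha_1,\alpha_2,\alpha_3}\binom{m-1}{\beta_1,\beta_2,\beta_3}\sum_{p=0}^{\alpha_2+\beta_2}\ \sum_{q=0}^{\alpha_3+\beta_3}\frac{(-1)^{p+q}\binom{\alpha_2+\beta_2}{p}\binom{\alpha_3+\beta_3}{q}}{(p+q+1)\,(\alpha_1+\beta_1+\alpha_3+\beta_3-q+1)}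.$$
   Context: $\mathbb N$ includes $0$, and $\binom{m-1}{\alpha_1,\alpha_2,\alpha_3}=\frac{(m-1)!}{\alpha_1!\,\alpha_2!\,\alpha_3!}$ is the multinomial coefficient. The variables come from the substitution $Z_1=X_1$, $Z_2=X_2$, $Z_3=Y_1$, where $X_1,X_2,Y_1,Y_2$ are subject to the linear constraint $X_1+X_2+Y_1+Y_2=0$, so that $u=Y_1$, $v=Y_2$, $t=-X_2$, $u+v-t=-X_1$. The quotient defining $\mathcal P_m$ is exact, since the numerator is divisible by $(u-t)(v-t)$. *)

theory Defs
  imports Complex_Main "HOL-Computational_Algebra.Polynomial"
begin

text \<open>
  The polynomial ring $\mathbb{R}[Z_1,Z_2,Z_3]$ is represented as the iterated univariate
  polynomial ring $\mathbb{R}[Z_1][Z_2][Z_3]$.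
\<close>

type_synonym poly3 = "real poly poly poly"

definition cst :: "real \<Rightarrow> poly3" where
  "cst c = [:[:[:c:]:]:]"

definition Z1 :: poly3 where "Z1 = [:[:[:0, 1:]:]:]"
definition Z2 :: poly3 where "Z2 = [:[:0, 1:]:]"
definition Z3 :: poly3 where "Z3 = [:0, 1:]"

definition u_var :: poly3 where "u_var = Z3"
definition v_var :: poly3 where "v_var = - Z1 - Z2 - Z3"
definition t_var :: poly3 where "t_var = - Z2"

definition P_num :: "nat \<Rightarrow> poly3" where
  "P_num m = (u_var + v_var - t_var) ^ (2 * m) + t_var ^ (2 * m) - u_var ^ (2 * m) - v_var ^ (2 * m)"

definition P_den :: poly3 where
  "P_den = (u_var - t_var) * (v_var - t_var)"

text \<open>
  The \<open>div\<close> below is division in the integral domain \<^typ>\<open>poly3\<close>; it is exact by the lemmas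
  \<open>P_den_nonzero\<close> and \<open>P_den_dvd_P_num\<close> proved afterwards.
\<close>

definition P_poly :: "nat \<Rightarrow> poly3" where
  "P_poly m = cst (1 / (2 * real ((2 * m) choose m))) * (P_num m div P_den)"

lemma P_den_nonzero: "P_den \<noteq> 0"
  by (simp add: P_den_def u_var_def v_var_def t_var_def Z1_def Z2_def Z3_def)

lemma mixed_power_difference_dvd:
  fixes u v t :: "'a :: comm_ring_1"
  shows "(u - t) * (v - t) dvd (u + v - t) ^ n + t ^ n - u ^ n - v ^ n"
proof (induction n)
  case 0
  then show ?case by simp
next
  case (Suc n)
  have split: "(u + v - t) ^ Suc n + t ^ Suc n - u ^ Suc n - v ^ Suc n =
     (u + v - t) * ((u + v - t) ^ n + t ^ n - u ^ n - v ^ n)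
       + (u - t) * (v ^ n - t ^ n) + (u ^ n - t ^ n) * (v - t)"
    by (simp add: algebra_simps)
  have pow: "x - t dvd x ^ n - t ^ n" for x
    using power_diff_sumr2[of x n t] by (metis dvd_triv_left)
  show ?case
    unfolding split
    by (intro dvd_add dvd_mult[OF Suc] mult_dvd_mono pow dvd_refl)
qed

lemma P_den_dvd_P_num: "P_den dvd P_num m"
  unfolding P_den_def P_num_def by (rule mixed_power_difference_dvd)

lemma P_poly_exact: "cst (2 * real ((2 * m) choose m)) * P_den * P_poly m = P_num m"
proof -
  have "cst a * cst b = cst (a * b)" for a b
    by (simp add: cst_def)
  moreover have "cst 1 = 1"
    by (simp add: cst_def one_pCons)
  moreover have "P_den * (P_num m div P_den) = P_num m"
    using P_den_dvd_P_num by simp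
  moreover have "2 * real ((2 * m) choose m) \<noteq> 0"
    by simp
  ultimately show ?thesis
    unfolding P_poly_def
    by (metis (no_types, opaque_lifting) mult.assoc mult.commute mult_1 nonzero_eq_divide_eq)
qed

type_synonym multi_index = "nat \<times> nat \<times> nat"

definition multi_indices :: "nat \<Rightarrow> multi_index set" where
  "multi_indices d = {(a1, a2, a3). a1 + a2 + a3 = d}"

lemma finite_multi_indices: "finite (multi_indices d)"
  by (rule finite_subset[of _ "{..d} \<times> {..d} \<times> {..d}"]) (auto simp: multi_indices_def)

fun monomial_at :: "multi_index \<Rightarrow> poly3" where
  "monomial_at (a1, a2, a3) = Z1 ^ a1 * Z2 ^ a2 * Z3 ^ a3"

fun multinom3 :: "nat \<Rightarrow> multi_index \<Rightarrow> real" where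
  "multinom3 n (a1, a2, a3) = fact n / (fact a1 * fact a2 * fact a3)"

text \<open>
  A square matrix whose rows and columns are indexed by a finite set \<open>I\<close> is a function of two
  indices, of which only the values on \<open>I \<times> I\<close> matter. Symmetry is part of positive
  semidefiniteness.
\<close>

definition psd_on :: "'i set \<Rightarrow> ('i \<Rightarrow> 'i \<Rightarrow> real) \<Rightarrow> bool" where
  "psd_on I M \<longleftrightarrow>
     (\<forall>a\<in>I. \<forall>b\<in>I. M a b = M b a) \<and>
     (\<forall>x :: 'i \<Rightarrow> real. 0 \<le> (\<Sum>a\<in>I. \<Sum>b\<in>I. x a * M a b * x b))"

definition W_form :: "nat \<Rightarrow> (multi_index \<Rightarrow> multi_index \<Rightarrow> real) \<Rightarrow> poly3" where
  "W_form m M =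
     (\<Sum>a\<in>multi_indices (m - 1). \<Sum>b\<in>multi_indices (m - 1).
        monomial_at a * cst (M a b) * monomial_at b)"

fun M_entry :: "nat \<Rightarrow> multi_index \<Rightarrow> multi_index \<Rightarrow> real" where
  "M_entry m (a1, a2, a3) (b1, b2, b3) =
     real m * (2 * real m - 1) / real ((2 * m) choose m)
       * multinom3 (m - 1) (a1, a2, a3) * multinom3 (m - 1) (b1, b2, b3)
       * (\<Sum>p = 0..a2 + b2. \<Sum>q = 0..a3 + b3.
            (- 1) ^ (p + q) * real ((a2 + b2) choose p) * real ((a3 + b3) choose q)
            / ((real p + real q + 1)
               * (real a1 + real b1 + real a3 + real b3 - real q + 1)))"

end

theory Submission
  imports Defs "HOL-Analysis.Equivalence_Lebesgue_Henstock_Integration"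
begin

text \<open>
  The matrix is a Gram matrix of polynomials on the unit square. For any twice continuously
  differentiable function $f$, the mixed difference $f(u+v-t)+f(t)-f(u)-f(v)$ equals $(u-t)(v-t)$ times the
  integral of $f''$ at the point $t+r(u-t)+s(v-t)$ over $(r,s)\in[0,1]^2$, by the fundamental
  theorem of calculus in each of the two directions. With $f(x)=x^{2m}$ this removes the denominator:
  \[ \mathcal P_m = \frac{m(2m-1)}{\binom{2m}{m}} \int_0^1\!\int_0^1
       (t+r(u-t)+s(v-t))^{2(m-1)}\,ds\,dr \]
  (\<open>mixed_difference_integral\<close>). In the variables $Z$ the base of the power is $-L$ with
  $L = sZ_1+(1-r)Z_2+(s-r)Z_3$, and the exponent is even, so the integrand is the square of
  $L^{m-1}$. The trinomial theorem writes $L^{m-1}$ as the sum of the monomials $Z^\alpha$ with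
  coefficients
  \[ g_\alpha(r,s) = \binom{m-1}{\alpha_1,\alpha_2,\alpha_3}
       s^{\alpha_1}(1-r)^{\alpha_2}(s-r)^{\alpha_3}. \]
  Hence the matrix with entries $\frac{m(2m-1)}{\binom{2m}{m}}\int\!\int g_\alpha g_\beta$
  represents $\mathcal P_m$. It is positive semidefinite because its quadratic form at a vector $w$ is
  a nonnegative multiple of the integral of $(\sum_\alpha w_\alpha g_\alpha)^2$
  (\<open>M_entry_quadratic_form\<close>). Expanding $(1-r)^{\alpha_2+\beta_2}$ and
  $(s-r)^{\alpha_3+\beta_3}$ binomially and integrating term by term gives the double sum in the
  definition of the entries (\<open>M_entry_eq_integral\<close>).

  The integrals live over real numbers, so the identity of polynomials is obtained from the
  identity of their values at all real points (\<open>poly3_eqI\<close>), after multiplication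
  by the denominator.
\<close>

section \<open>Integration over the unit square\<close>

text \<open>
  An iterated integral, so that the fundamental theorem of calculus applies to one variable
  at a time.
\<close>

definition square_integral :: "(real \<Rightarrow> real \<Rightarrow> real) \<Rightarrow> real" where
  "square_integral g = integral {0..1} (\<lambda>r. integral {0..1} (\<lambda>s. g r s))"

abbreviation jointly_continuous :: "(real \<Rightarrow> real \<Rightarrow> real) \<Rightarrow> bool" where
  "jointly_continuous g \<equiv> continuous_on UNIV (\<lambda>p. g (fst p) (snd p))"

lemma inner_integrable:
  assumes "jointly_continuous g"
  shows "(\<lambda>s. g r s) integrable_on {0..1}"
proof -
  have "continuous_on {0..1} (\<lambda>s. (\<lambda>p. g (fst p) (snd p)) (r, s))"
    by (rule continuous_on_compose2[OF assms]) (auto intro!: continuous_intros)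
  then show ?thesis
    by (intro integrable_continuous_real) simp
qed

lemma outer_integrable:
  assumes "jointly_continuous g"
  shows "(\<lambda>r. integral {0..1} (\<lambda>s. g r s)) integrable_on {0..1}"
proof -
  have "continuous_on ({0..1} \<times> cbox 0 1) (\<lambda>(r, s). g r s)"
    using continuous_on_subset[OF assms] by (simp add: case_prod_beta)
  then have "continuous_on {0..1} (\<lambda>r. integral (cbox 0 1) (\<lambda>s. g r s))"
    by (rule integral_continuous_on_param)
  then show ?thesis
    by (intro integrable_continuous_real) simp
qed

lemma square_integral_sum:
  assumes "finite A" "\<And>a. a \<in> A \<Longrightarrow> jointly_continuous (g a)"
  shows "square_integral (\<lambda>r s. \<Sum>a\<in>A. g a r s) = (\<Sum>a\<in>A. square_integral (g a))"
  unfolding square_integral_def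
  using assms by (simp add: integral_sum inner_integrable outer_integrable)

lemma square_integral_cmult: "square_integral (\<lambda>r s. c * g r s) = c * square_integral g"
  by (simp add: square_integral_def)

lemma square_integral_nonneg:
  assumes "jointly_continuous g" "\<And>r s. 0 \<le> g r s"
  shows "0 \<le> square_integral g"
  unfolding square_integral_def
  by (intro integral_nonneg outer_integrable inner_integrable assms)

text \<open>
  The factor \<open>b\<close> stays on the left: no division takes place, so that the degenerate
  segment \<open>b = 0\<close> is covered.
\<close>

lemma segment_power_integral:
  "b * integral {0..1} (\<lambda>s. (real n + 1) * (a + s * b) ^ n) = (a + b) ^ (n + 1) - a ^ (n + 1)"
proof -
  have "((\<lambda>s. b * ((real n + 1) * (a + s * b) ^ n)) has_integral
      (a + 1 * b) ^ (n + 1) - (a + 0 * b) ^ (n + 1)) {0..1}"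
  proof (rule fundamental_theorem_of_calculus)
    fix s :: real
    have "((\<lambda>s. (a + s * b) ^ (n + 1)) has_real_derivative
        b * ((real n + 1) * (a + s * b) ^ n)) (at s within {0..1})"
      by (rule derivative_eq_intros refl | simp del: power_Suc)+
    then show "((\<lambda>s. (a + s * b) ^ (n + 1)) has_vector_derivative
        b * ((real n + 1) * (a + s * b) ^ n)) (at s within {0..1})"
      by (simp only: has_real_derivative_iff_has_vector_derivative)
  qed simp
  then show ?thesis
    by (simp flip: integral_mult_right add: integral_unique)
qed

lemma square_integral_monomial:
  "square_integral (\<lambda>r s. r ^ i * s ^ j) = 1 / ((real i + 1) * (real j + 1))"
proof -
  have "integral {0..1} (\<lambda>x::real. x ^ n) = 1 / (real n + 1)" for n
    using segment_power_integral[of 1 n 0]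
    unfolding integral_mult_right by (simp add: field_simps)
  then show ?thesis by (simp add: square_integral_def)
qed

text \<open>
  The two binomial expansions are responsible for the sums over \<open>p\<close> and \<open>q\<close>;
  the exponents of \<open>r\<close> and \<open>s\<close> in the resulting monomials,
  \<open>p + q\<close> and \<open>A + C - q\<close>, are responsible for the denominators.
\<close>

lemma square_integral_moment:
  "square_integral (\<lambda>r s. s ^ A * (1 - r) ^ B * (s - r) ^ C) =
    (\<Sum>p = 0..B. \<Sum>q = 0..C. (- 1) ^ (p + q) * real (B choose p) * real (C choose q)
       / ((real p + real q + 1) * (real A + real C - real q + 1)))"
proof -
  have B: "(1 - r) ^ B = (\<Sum>p = 0..B. real (B choose p) * (- r) ^ p)" for r :: real
    using binomial_ring[of "- r" 1 B] by (simp add: atMost_atLeast0)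
  have C: "(s - r) ^ C = (\<Sum>q = 0..C. real (C choose q) * (- r) ^ q * s ^ (C - q))" for r s :: real
    using binomial_ring[of "- r" s C] by (simp add: atMost_atLeast0)
  have expand: "s ^ A * (1 - r) ^ B * (s - r) ^ C =
      (\<Sum>p = 0..B. \<Sum>q = 0..C. ((- 1) ^ (p + q) * real (B choose p) * real (C choose q))
         * (r ^ (p + q) * s ^ (A + (C - q))))" for r s
  proof -
    have "s ^ A * (1 - r) ^ B * (s - r) ^ C =
        (\<Sum>p = 0..B. s ^ A * (real (B choose p) * (- r) ^ p)) *
        (\<Sum>q = 0..C. real (C choose q) * (- r) ^ q * s ^ (C - q))"
      unfolding B C sum_distrib_left ..
    then show ?thesis
      by (simp only: sum_product power_add power_minus[of r] mult_ac)
  qed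
  have "square_integral (\<lambda>r s. s ^ A * (1 - r) ^ B * (s - r) ^ C) =
      (\<Sum>p = 0..B. \<Sum>q = 0..C. ((- 1) ^ (p + q) * real (B choose p) * real (C choose q))
         * square_integral (\<lambda>r s. r ^ (p + q) * s ^ (A + (C - q))))"
    unfolding expand square_integral_cmult[symmetric]
    by (simp add: square_integral_sum continuous_intros)
  also have "\<dots> = (\<Sum>p = 0..B. \<Sum>q = 0..C. (- 1) ^ (p + q) * real (B choose p) * real (C choose q)
       / ((real p + real q + 1) * (real A + real C - real q + 1)))"
    by (intro sum.cong refl) (simp add: square_integral_monomial of_nat_diff algebra_simps)
  finally show ?thesis .
qed

text \<open>
  Integrating the second derivative of $x^{n+2}$ in the direction $v-t$ turns it into a difference of first
  derivatives along two parallel segments of direction $u-t$, starting at $v$ and at $t$; integrating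
  these leaves the values at the four corners of the parallelogram.
\<close>

lemma mixed_difference_integral:
  "(u - t) * (v - t) * ((real n + 1) * (real n + 2) *
      square_integral (\<lambda>r s. (t + r * (u - t) + s * (v - t)) ^ n)) =
    (u + v - t) ^ (n + 2) + t ^ (n + 2) - u ^ (n + 2) - v ^ (n + 2)"
proof -
  let ?a = "u - t" and ?b = "v - t"
  let ?k = "real n + 2"
  have inner: "?b * ((real n + 1) * integral {0..1} (\<lambda>s. (t + r * ?a + s * ?b) ^ n)) =
      (v + r * ?a) ^ (n + 1) - (t + r * ?a) ^ (n + 1)" for r
  proof -
    have "t + r * ?a + ?b = v + r * ?a" by simp
    then show ?thesis
      using segment_power_integral[of ?b n "t + r * ?a"] by (simp only: integral_mult_right)
  qed
  have cont: "(\<lambda>r. ?k * (c + r * ?a) ^ (n + 1)) integrable_on {0..1}" for c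
    by (intro integrable_continuous_real continuous_intros)
  have "?a * ?b * ((real n + 1) * ?k * square_integral (\<lambda>r s. (t + r * ?a + s * ?b) ^ n)) =
      ?a * (?k * integral {0..1} (\<lambda>r. ?b * ((real n + 1) * integral {0..1} (\<lambda>s. (t + r * ?a + s * ?b) ^ n))))"
    by (simp add: square_integral_def)
  also have "\<dots> = ?a * integral {0..1} (\<lambda>r. ?k * (v + r * ?a) ^ (n + 1) - ?k * (t + r * ?a) ^ (n + 1))"
    unfolding inner by (simp add: right_diff_distrib flip: integral_mult_right)
  also have "\<dots> = ?a * integral {0..1} (\<lambda>r. ?k * (v + r * ?a) ^ (n + 1))
      - ?a * integral {0..1} (\<lambda>r. ?k * (t + r * ?a) ^ (n + 1))"
    unfolding integral_diff[OF cont cont] by (rule right_diff_distrib)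
  also have "\<dots> = ((v + ?a) ^ (n + 2) - v ^ (n + 2)) - ((t + ?a) ^ (n + 2) - t ^ (n + 2))"
    using segment_power_integral[of ?a "n + 1" v] segment_power_integral[of ?a "n + 1" t]
    by (simp add: add.commute)
  finally show ?thesis by (simp add: algebra_simps)
qed

section \<open>The Gram matrix\<close>

fun monomial_value :: "real \<Rightarrow> real \<Rightarrow> real \<Rightarrow> multi_index \<Rightarrow> real" where
  "monomial_value x y z (a1, a2, a3) = x ^ a1 * y ^ a2 * z ^ a3"

text \<open>
  Splitting off \<open>z\<close> and then \<open>y\<close> by the binomial theorem produces a sum over
  pairs \<open>j \<le> i \<le> n\<close>, where \<open>i\<close> is the joint exponent of
  \<open>x\<close> and \<open>y\<close>; such pairs are the multi-indices \<open>(j, i - j, n - i)\<close>.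
\<close>

lemma trinomial_theorem:
  "(x + y + z) ^ n = (\<Sum>a\<in>multi_indices n. multinom3 n a * monomial_value x y z a)"
proof -
  have ix: "multi_indices n = (\<lambda>(i, j). (j, i - j, n - i)) ` (SIGMA i:{..n}. {..i})"
  proof (intro equalityI subsetI)
    fix a assume "a \<in> multi_indices n"
    then obtain a1 a2 a3 where "a = (a1, a2, a3)" "a1 + a2 + a3 = n"
      by (auto simp: multi_indices_def)
    then show "a \<in> (\<lambda>(i, j). (j, i - j, n - i)) ` (SIGMA i:{..n}. {..i})"
      by (intro image_eqI[of _ _ "(a1 + a2, a1)"]) auto
  qed (auto simp: multi_indices_def)
  have inj: "inj_on (\<lambda>(i, j). (j, i - j, n - i)) (SIGMA i:{..n}. {..i})"
    by (auto simp: inj_on_def)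
  have "(x + y + z) ^ n = (\<Sum>i\<le>n. \<Sum>j\<le>i. real (n choose i) * real (i choose j)
      * (x ^ j * y ^ (i - j) * z ^ (n - i)))"
    by (simp add: binomial_ring[of "x + y"] binomial_ring[of x] sum_distrib_left sum_distrib_right mult_ac)
  also have "\<dots> = (\<Sum>i\<le>n. \<Sum>j\<le>i. multinom3 n (j, i - j, n - i) * monomial_value x y z (j, i - j, n - i))"
    by (intro sum.cong refl) (simp add: binomial_fact)
  also have "\<dots> = (\<Sum>a\<in>multi_indices n. multinom3 n a * monomial_value x y z a)"
    unfolding ix by (subst sum.reindex[OF inj]) (simp add: sum.Sigma case_prod_beta)
  finally show ?thesis .
qed

abbreviation M_factor :: "nat \<Rightarrow> real" where
  "M_factor m \<equiv> real m * (2 * real m - 1) / real ((2 * m) choose m)"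

text \<open>
  The entries are, up to a common factor, the $L^2$ inner products of the coefficient functions of
  $L^{m-1}$: the exponents in a product of two such functions add up, which leaves two multinomial
  coefficients and the moment with exponents $\alpha+\beta$.
\<close>

lemma M_entry_eq_integral:
  "M_entry m a b = M_factor m * square_integral (\<lambda>r s.
     (multinom3 (m - 1) a * monomial_value s (1 - r) (s - r) a) *
     (multinom3 (m - 1) b * monomial_value s (1 - r) (s - r) b))"
proof -
  obtain a1 a2 a3 b1 b2 b3 where ab: "a = (a1, a2, a3)" "b = (b1, b2, b3)"
    by (metis prod_cases3)
  have "square_integral (\<lambda>r s.
       (multinom3 (m - 1) a * monomial_value s (1 - r) (s - r) a) *
       (multinom3 (m - 1) b * monomial_value s (1 - r) (s - r) b)) =
     square_integral (\<lambda>r s. (multinom3 (m - 1) a * multinom3 (m - 1) b) *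
       (s ^ (a1 + b1) * (1 - r) ^ (a2 + b2) * (s - r) ^ (a3 + b3)))"
    unfolding ab monomial_value.simps power_add by (simp only: mult_ac)
  also have "\<dots> = (multinom3 (m - 1) a * multinom3 (m - 1) b) *
      (\<Sum>p = 0..a2 + b2. \<Sum>q = 0..a3 + b3.
            (- 1) ^ (p + q) * real ((a2 + b2) choose p) * real ((a3 + b3) choose q)
            / ((real p + real q + 1)
               * (real (a1 + b1) + real (a3 + b3) - real q + 1)))"
    unfolding square_integral_cmult square_integral_moment ..
  finally show ?thesis
    unfolding ab M_entry.simps by (simp only: of_nat_add mult.assoc add.assoc)
qed

lemma continuous_monomial_value [continuous_intros]:
  assumes "continuous_on S f" "continuous_on S g" "continuous_on S h"
  shows "continuous_on S (\<lambda>p. monomial_value (f p) (g p) (h p) a)"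
  using assms by (cases a) (auto intro!: continuous_intros)

text \<open>
  One formula serves both claims: arbitrary weights give positive semidefiniteness, and the
  values of the monomials as weights give the value of the represented polynomial.
\<close>

lemma M_entry_quadratic_form:
  "(\<Sum>a\<in>multi_indices (m - 1). \<Sum>b\<in>multi_indices (m - 1). w a * M_entry m a b * w b) =
    M_factor m * square_integral (\<lambda>r s.
      (\<Sum>a\<in>multi_indices (m - 1). w a * (multinom3 (m - 1) a * monomial_value s (1 - r) (s - r) a))\<^sup>2)"
proof -
  let ?I = "multi_indices (m - 1)"
  let ?f = "\<lambda>a r s. multinom3 (m - 1) a * monomial_value s (1 - r) (s - r) a"
  have "w a * M_entry m a b * w b =
      M_factor m * square_integral (\<lambda>r s. (w a * ?f a r s) * (w b * ?f b r s))" for a b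
  proof -
    have "(\<lambda>r s. (w a * ?f a r s) * (w b * ?f b r s)) = (\<lambda>r s. (w a * w b) * (?f a r s * ?f b r s))"
      by (simp add: mult_ac)
    then show ?thesis
      by (simp only: square_integral_cmult M_entry_eq_integral mult_ac)
  qed
  then have "(\<Sum>a\<in>?I. \<Sum>b\<in>?I. w a * M_entry m a b * w b) =
      M_factor m * (\<Sum>a\<in>?I. \<Sum>b\<in>?I. square_integral (\<lambda>r s. (w a * ?f a r s) * (w b * ?f b r s)))"
    by (simp only: sum_distrib_left)
  also have "(\<Sum>a\<in>?I. \<Sum>b\<in>?I. square_integral (\<lambda>r s. (w a * ?f a r s) * (w b * ?f b r s))) =
      square_integral (\<lambda>r s. (\<Sum>a\<in>?I. \<Sum>b\<in>?I. (w a * ?f a r s) * (w b * ?f b r s)))"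
    by (simp add: square_integral_sum finite_multi_indices continuous_intros)
  finally show ?thesis
    by (simp only: power2_eq_square sum_product)
qed

lemma psd_M_entry:
  assumes "m \<ge> 1"
  shows "psd_on (multi_indices (m - 1)) (M_entry m)"
  unfolding psd_on_def
proof (intro conjI ballI allI)
  fix a b :: multi_index
  show "M_entry m a b = M_entry m b a"
    unfolding M_entry_eq_integral by (simp only: mult.commute)
next
  fix x :: "multi_index \<Rightarrow> real"
  show "0 \<le> (\<Sum>a\<in>multi_indices (m - 1). \<Sum>b\<in>multi_indices (m - 1). x a * M_entry m a b * x b)"
    unfolding M_entry_quadratic_form
    using assms by (intro mult_nonneg_nonneg square_integral_nonneg) (auto intro!: continuous_intros)
qed

section \<open>From values to polynomials\<close>

definition eval3 :: "real \<Rightarrow> real \<Rightarrow> real \<Rightarrow> poly3 \<Rightarrow> real" where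
  "eval3 x y z p = poly (poly (poly p [:[:z:]:]) [:y:]) x"

lemma eval3_ring [simp]:
  "eval3 x y z (p + q) = eval3 x y z p + eval3 x y z q"
  "eval3 x y z (p - q) = eval3 x y z p - eval3 x y z q"
  "eval3 x y z (- p) = - eval3 x y z p"
  "eval3 x y z (p * q) = eval3 x y z p * eval3 x y z q"
  "eval3 x y z (p ^ n) = eval3 x y z p ^ n"
  "eval3 x y z (\<Sum>i\<in>I. f i) = (\<Sum>i\<in>I. eval3 x y z (f i))"
  by (simp_all add: eval3_def poly_sum poly_power)

lemma eval3_generators [simp]:
  "eval3 x y z (cst c) = c" "eval3 x y z Z1 = x" "eval3 x y z Z2 = y" "eval3 x y z Z3 = z"
  by (simp_all add: eval3_def cst_def Z1_def Z2_def Z3_def)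

lemma eval3_monomial [simp]: "eval3 x y z (monomial_at a) = monomial_value x y z a"
  by (cases a) simp

text \<open>
  The coefficients may themselves be polynomials; it is enough to have roots among the real
  constants, embedded by \<open>f\<close>, as there are infinitely many of them.
\<close>

lemma poly_zero_if_infinite_roots:
  fixes p :: "'a :: idom poly"
  assumes "inj f" "\<And>c :: real. poly p (f c) = 0"
  shows "p = 0"
proof (rule ccontr)
  assume "p \<noteq> 0"
  then have "finite {x. poly p x = 0}" by (rule poly_roots_finite)
  then have "finite (range f)" by (rule finite_subset[rotated]) (use assms in auto)
  then show False
    using \<open>inj f\<close> by (simp add: finite_image_iff infinite_UNIV_char_0)
qed

lemma poly3_eqI:
  assumes "\<And>x y z. eval3 x y z p = eval3 x y z q"
  shows "p = q"
proof -
  have "poly (poly (poly (p - q) [:[:z:]:]) [:y:]) x = 0" for x y z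
    using assms[of x y z] by (simp add: eval3_def)
  then have "poly (poly (p - q) [:[:z:]:]) [:y:] = 0" for y z
    by (intro poly_zero_if_infinite_roots[of id]) auto
  then have "poly (p - q) [:[:z:]:] = 0" for z
    by (intro poly_zero_if_infinite_roots[of "\<lambda>y. [:y:]"]) (auto simp: inj_def)
  then have "p - q = 0"
    by (intro poly_zero_if_infinite_roots[of "\<lambda>z. [:[:z:]:]"]) (auto simp: inj_def)
  then show ?thesis by simp
qed

text \<open>
  With the values of the monomials as weights, the sum under the square is a trinomial expansion,
  because $x^{a_1} s^{a_1} = (sx)^{a_1}$ and likewise for the other two variables.
\<close>

lemma eval3_W_form:
  "eval3 x y z (W_form m (M_entry m)) =
    M_factor m * square_integral (\<lambda>r s. (s * x + (1 - r) * y + (s - r) * z) ^ (2 * (m - 1)))"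
proof -
  have "monomial_value x y z a * (multinom3 (m - 1) a * monomial_value s (1 - r) (s - r) a) =
      multinom3 (m - 1) a * monomial_value (s * x) ((1 - r) * y) ((s - r) * z) a" for a r s
    by (cases a) (simp add: power_mult_distrib)
  then have "(\<Sum>a\<in>multi_indices (m - 1). monomial_value x y z a *
        (multinom3 (m - 1) a * monomial_value s (1 - r) (s - r) a))\<^sup>2 =
      (s * x + (1 - r) * y + (s - r) * z) ^ (2 * (m - 1))" for r s
    by (simp only: trinomial_theorem[symmetric] power_mult[symmetric] mult.commute)
  then show ?thesis
    by (simp only: W_form_def eval3_ring eval3_generators eval3_monomial M_entry_quadratic_form)
qed

lemma W_form_M_entry_times_den:
  assumes "m \<ge> 1"
  shows "cst (2 * real ((2 * m) choose m)) * P_den * W_form m (M_entry m) = P_num m"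
proof (rule poly3_eqI)
  fix x y z :: real
  define u v t where "u = z" and "v = - x - y - z" and "t = - y"
  define n where "n = 2 * (m - 1)"
  have n: "2 * m = n + 2" using assms by (simp add: n_def)
  have nreal: "2 * real m = real n + 2" using n by linarith
  have "even n" by (simp add: n_def)
  \<comment> \<open>The sign is harmless because the exponent is even.\<close>
  have "t + r * (u - t) + s * (v - t) = - (s * x + (1 - r) * y + (s - r) * z)" for r s
    by (simp add: u_def v_def t_def algebra_simps)
  then have "(s * x + (1 - r) * y + (s - r) * z) ^ n = (t + r * (u - t) + s * (v - t)) ^ n" for r s
    using \<open>even n\<close> by (simp only: power_minus_even)
  then have W: "eval3 x y z (W_form m (M_entry m)) =
      M_factor m * square_integral (\<lambda>r s. (t + r * (u - t) + s * (v - t)) ^ n)"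
    by (simp only: eval3_W_form n_def)
  have factor: "2 * real ((2 * m) choose m) * M_factor m = (real n + 1) * (real n + 2)"
  proof -
    have "2 * real ((2 * m) choose m) * M_factor m = (2 * real m) * (2 * real m - 1)"
      by simp
    then show ?thesis unfolding nreal by (simp add: algebra_simps)
  qed
  have "eval3 x y z (cst (2 * real ((2 * m) choose m)) * P_den * W_form m (M_entry m)) =
      (u - t) * (v - t) * ((2 * real ((2 * m) choose m) * M_factor m) *
        square_integral (\<lambda>r s. (t + r * (u - t) + s * (v - t)) ^ n))"
    by (simp only: eval3_ring W P_den_def u_var_def v_var_def t_var_def eval3_generators u_def v_def t_def mult_ac)
  also have "\<dots> = (u + v - t) ^ (n + 2) + t ^ (n + 2) - u ^ (n + 2) - v ^ (n + 2)"
    unfolding factor by (rule mixed_difference_integral)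
  also have "\<dots> = eval3 x y z (P_num m)"
    by (simp only: eval3_ring P_num_def n u_var_def v_var_def t_var_def eval3_generators u_def v_def t_def)
  finally show "eval3 x y z (cst (2 * real ((2 * m) choose m)) * P_den * W_form m (M_entry m)) =
      eval3 x y z (P_num m)" .
qed

lemma P_poly_eq_W_form:
  assumes "m \<ge> 1"
  shows "P_poly m = W_form m (M_entry m)"
proof -
  have "cst (2 * real ((2 * m) choose m)) * P_den \<noteq> 0"
    using P_den_nonzero by (simp add: cst_def)
  moreover have "cst (2 * real ((2 * m) choose m)) * P_den * P_poly m =
      cst (2 * real ((2 * m) choose m)) * P_den * W_form m (M_entry m)"
    using P_poly_exact W_form_M_entry_times_den[OF assms] by simp
  ultimately show ?thesis by (metis mult_cancel_left)
qed

theorem proposition8p1: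
  fixes m :: nat
  assumes "m \<ge> 1"
  shows "(\<exists>M :: multi_index \<Rightarrow> multi_index \<Rightarrow> real.
            psd_on (multi_indices (m - 1)) M \<and> P_poly m = W_form m M)
       \<and> psd_on (multi_indices (m - 1)) (M_entry m)
       \<and> P_poly m = W_form m (M_entry m)"
  using psd_M_entry[OF assms] P_poly_eq_W_form[OF assms] by blast

end
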